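(* Let $n,m\ge 1$, let $\mathcal{P}$ be a facet-bipartite $n$-polytope and let $\mathcal{Q}$ be a vertex-bipartite $m$-polytope (with any choice of base flags). Let $\mathcal{M} = \mathcal{P} | \mathcal{Q}$ be their flat amalgamation. Then $\mathcal{M}$ is an $(m+n-1)$-polytope that is $(n-2,n)$-flat.
   Context: For an integer $n\ge 1$, an $n$-pre-maniplex is an $n$-regular simple graph (its nodes are called flags) whose edges are colored with $0,1,\ldots,n-1$ so that each flag is incident to exactly one edge of each color; $\Phi^i$ denotes the other endpoint of the edge of color $i$ at the flag $\Phi$. An $n$-maniplex is a connected $n$-pre-maniplex in which $(\Phi^i)^j=(\Phi^j)^i$ for every flag $\Phi$ and all colors $i,j$ with $|i-j|>1$. An $n$-polytope (identified with its flag graph) is an $n$-maniplex satisfying the Path Intersection Property: for every pair of flags $\Phi,\Psi$ and all colors $i\le j$, if there is a path from $\Phi$ to $\Psi$ using only colors in $\{i,\ldots,n-1\}$ and another path from $\Phi$ to $\Psi$ using only colors in $\{0,\ldots,j\}$, then there is a path from $\Phi$ to $\Psi$ using only colors in $\{i,\ldots,j\}$. An $n$-polytope is facet-bipartite if it has no cycle with an odd number of edges of color $n-1$, and vertex-bipartite if it has no cycle with an odd number of edges of color $0$. The $i$-faces of an $n$-maniplex are the connected components of the graph obtained by deleting all edges of color $i$. Two faces are incident if they have a flag in common. A polytope is $(i,j)$-flat if every $i$-face is incident to every $j$-face; equivalently, for every flag $\Phi$ and every $j$-face there is a path from $\Phi$ to some flag in that $j$-face that uses no edge of color $i$. (If $i=-1$,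 or if $j$ equals the rank of the polytope, no edges are deleted, and the whole polytope is the only face of that rank.) Flat amalgamation: let $\mathcal{P}$ be an $n$-polytope with base flag $\Phi$ and $\mathcal{Q}$ an $m$-polytope with base flag $\Psi$. On pairs $(\Lambda,\Delta)$ with $\Lambda$ a flag of $\mathcal{P}$ and $\Delta$ a flag of $\mathcal{Q}$, define for $0\le i\le m+n-2$: $(\Lambda,\Delta)^i=(\Lambda^i,\Delta)$ if $i<n-1$; $(\Lambda,\Delta)^{n-1}=(\Lambda^{n-1},\Delta^0)$; $(\Lambda,\Delta)^i=(\Lambda,\Delta^{i-n+1})$ if $n\le i\le m+n-2$. Join $(\Lambda,\Delta)$ to $(\Lambda,\Delta)^i$ by an edge of color $i$. The flat amalgamation $\mathcal{P}|\mathcal{Q}=(\mathcal{P},\Phi)|(\mathcal{Q},\Psi)$ is the connected component of this edge-colored graph that contains $(\Phi,\Psi)$. *)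

theory Defs
  imports Main
begin

text \<open>
  A properly edge-coloured graph in which each flag has exactly one edge of each colour is
  represented by its set of flags and the maps sending \<open>\<Phi>\<close> to \<open>\<Phi>\<^sup>i\<close>, written \<open>adj M i \<Phi>\<close>. The edges
  of colour \<open>i\<close> are the pairs \<open>{\<Phi>, \<Phi>\<^sup>i}\<close>. The number \<open>n\<close> of colours is a separate parameter;
  \<open>adj M i \<Phi>\<close> is irrelevant for \<open>i \<ge> n\<close> or \<open>\<Phi>\<close> not a flag.
\<close>

record 'a colored_graph =
  flags :: "'a set"
  adj :: "nat \<Rightarrow> 'a \<Rightarrow> 'a"

text \<open>
  A walk is given by its initial flag and the list of the colours of its successive edges;
  \<open>walk_end\<close> is its final flag.
\<close>

definition walk_end :: "'a colored_graph \<Rightarrow> 'a \<Rightarrow> nat list \<Rightarrow> 'a" where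
  "walk_end M \<Phi> w = foldl (\<lambda>\<Lambda> i. adj M i \<Lambda>) \<Phi> w"

definition connected_by :: "'a colored_graph \<Rightarrow> nat set \<Rightarrow> 'a \<Rightarrow> 'a \<Rightarrow> bool" where
  "connected_by M C \<Phi> \<Psi> \<longleftrightarrow> \<Phi> \<in> flags M \<and> (\<exists>w. set w \<subseteq> C \<and> walk_end M \<Phi> w = \<Psi>)"

definition component :: "'a colored_graph \<Rightarrow> nat set \<Rightarrow> 'a \<Rightarrow> 'a set" where
  "component M C \<Phi> = {\<Psi>. connected_by M C \<Phi> \<Psi>}"

text \<open>
  The first three assumptions say that colour \<open>i\<close> is a perfect matching of the flags (in
  particular there are no loops), the fourth that there are no multiple edges.
\<close>

locale pre_maniplex =
  fixes n :: nat and M :: "'a colored_graph"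
  assumes rank_pos: "n \<ge> 1"
    and adj_closed: "\<lbrakk>\<Phi> \<in> flags M; i < n\<rbrakk> \<Longrightarrow> adj M i \<Phi> \<in> flags M"
    and adj_adj: "\<lbrakk>\<Phi> \<in> flags M; i < n\<rbrakk> \<Longrightarrow> adj M i (adj M i \<Phi>) = \<Phi>"
    and adj_neq: "\<lbrakk>\<Phi> \<in> flags M; i < n\<rbrakk> \<Longrightarrow> adj M i \<Phi> \<noteq> \<Phi>"
    and adj_distinct: "\<lbrakk>\<Phi> \<in> flags M; i < n; j < n; i \<noteq> j\<rbrakk> \<Longrightarrow> adj M i \<Phi> \<noteq> adj M j \<Phi>"

locale maniplex = pre_maniplex +
  assumes nonempty: "flags M \<noteq> {}"
    and connected: "\<lbrakk>\<Phi> \<in> flags M; \<Psi> \<in> flags M\<rbrakk> \<Longrightarrow> connected_by M {..<n} \<Phi> \<Psi>"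
    and adj_commute:
      "\<lbrakk>\<Phi> \<in> flags M; i < n; j < n; \<bar>int i - int j\<bar> > 1\<rbrakk>
        \<Longrightarrow> adj M j (adj M i \<Phi>) = adj M i (adj M j \<Phi>)"

locale polytope = maniplex +
  assumes path_intersection:
    "\<lbrakk>\<Phi> \<in> flags M; \<Psi> \<in> flags M; i \<le> j; j < n;
      connected_by M {i..n - 1} \<Phi> \<Psi>; connected_by M {0..j} \<Phi> \<Psi>\<rbrakk>
      \<Longrightarrow> connected_by M {i..j} \<Phi> \<Psi>"

text \<open>Cycles are simple: a closed walk of length at least 3 without repeated flags.\<close>

definition is_cycle :: "nat \<Rightarrow> 'a colored_graph \<Rightarrow> 'a \<Rightarrow> nat list \<Rightarrow> bool" where
  "is_cycle n M \<Phi> w \<longleftrightarrow>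
     \<Phi> \<in> flags M \<and> set w \<subseteq> {..<n} \<and> length w \<ge> 3 \<and> walk_end M \<Phi> w = \<Phi> \<and>
     distinct (map (\<lambda>k. walk_end M \<Phi> (take k w)) [0..<length w])"

definition facet_bipartite :: "nat \<Rightarrow> 'a colored_graph \<Rightarrow> bool" where
  "facet_bipartite n M \<longleftrightarrow> \<not> (\<exists>\<Phi> w. is_cycle n M \<Phi> w \<and> odd (count_list w (n - 1)))"

definition vertex_bipartite :: "nat \<Rightarrow> 'a colored_graph \<Rightarrow> bool" where
  "vertex_bipartite n M \<longleftrightarrow> \<not> (\<exists>\<Phi> w. is_cycle n M \<Phi> w \<and> odd (count_list w 0))"

text \<open>
  Faces are identified with their sets of flags. The rank \<open>i\<close> is an integer, so that for \<open>i = -1\<close>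
  and \<open>i = n\<close> no colour is deleted.
\<close>

definition faces :: "nat \<Rightarrow> 'a colored_graph \<Rightarrow> int \<Rightarrow> 'a set set" where
  "faces n M i = component M {c. c < n \<and> int c \<noteq> i} ` flags M"

definition incident :: "'a set \<Rightarrow> 'a set \<Rightarrow> bool" where
  "incident F G \<longleftrightarrow> F \<inter> G \<noteq> {}"

definition flat :: "nat \<Rightarrow> 'a colored_graph \<Rightarrow> int \<Rightarrow> int \<Rightarrow> bool" where
  "flat n M i j \<longleftrightarrow> (\<forall>F \<in> faces n M i. \<forall>G \<in> faces n M j. incident F G)"

definition amalgamation_graph ::
  "nat \<Rightarrow> 'a colored_graph \<Rightarrow> 'b colored_graph \<Rightarrow> ('a \<times> 'b) colored_graph" where
  "amalgamation_graph n P Q =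
     \<lparr>flags = flags P \<times> flags Q,
      adj = (\<lambda>i (\<Lambda>, \<Delta>).
        if i < n - 1 then (adj P i \<Lambda>, \<Delta>)
        else if i = n - 1 then (adj P (n - 1) \<Lambda>, adj Q 0 \<Delta>)
        else (\<Lambda>, adj Q (i - n + 1) \<Delta>))\<rparr>"

definition flat_amalgamation ::
  "nat \<Rightarrow> 'a colored_graph \<Rightarrow> 'a \<Rightarrow> nat \<Rightarrow> 'b colored_graph \<Rightarrow> 'b \<Rightarrow> ('a \<times> 'b) colored_graph" where
  "flat_amalgamation n P \<Phi> m Q \<Psi> =
     (let G = amalgamation_graph n P Q
      in G\<lparr>flags := component G {..<m + n - 1} (\<Phi>, \<Psi>)\<rparr>)"

end

theory Submission
  imports Defs
begin

text \<open>
  Every closed walk splits into cycles and backtracked edges, so facet- and vertex-bipartiteness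
  give 2-colourings \<open>\<beta>\<close> of the flags of \<open>P\<close> and \<open>\<gamma>\<close> of the flags of \<open>Q\<close> that switch precisely along
  the edges of colour \<open>n - 1\<close> and \<open>0\<close>, respectively. Normalised at the base flags, the flat
  amalgamation consists of all pairs \<open>(\<Lambda>, \<Delta>)\<close> with \<open>\<beta> \<Lambda> = \<gamma> \<Delta>\<close>. A walk in \<open>P\<close> lifts to a walk
  that moves the second coordinate only along a single edge of colour \<open>0\<close>, and dually for \<open>Q\<close>;
  since the first coordinate determines the class of the second, a walk in \<open>P\<close> and a walk in \<open>Q\<close>
  can be combined into one joining any two given pairs. Path intersection and flatness follow.
\<close>

section \<open>Walks\<close>

lemma walk_end_simps [simp]:
  "walk_end M \<Phi> [] = \<Phi>"
  "walk_end M \<Phi> (i # w) = walk_end M (adj M i \<Phi>) w"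
  "walk_end M \<Phi> (u @ v) = walk_end M (walk_end M \<Phi> u) v"
  by (simp_all add: walk_end_def)

lemma connected_by_refl: "\<Phi> \<in> flags M \<Longrightarrow> connected_by M C \<Phi> \<Phi>"
  unfolding connected_by_def by (auto intro: exI[of _ "[]"])

lemma connected_by_step:
  assumes "connected_by M C \<Phi> \<Psi>" "i \<in> C"
  shows "connected_by M C \<Phi> (adj M i \<Psi>)"
proof -
  obtain w where "\<Phi> \<in> flags M" "set w \<subseteq> C" "walk_end M \<Phi> w = \<Psi>"
    using assms(1) unfolding connected_by_def by blast
  then show ?thesis
    unfolding connected_by_def using assms(2) by (auto intro!: exI[of _ "w @ [i]"])
qed

lemma connected_by_trans:
  assumes "connected_by M C \<Phi> \<Psi>" "connected_by M C \<Psi> \<Omega>"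
  shows "connected_by M C \<Phi> \<Omega>"
proof -
  obtain u v where "\<Phi> \<in> flags M" "set u \<subseteq> C" "walk_end M \<Phi> u = \<Psi>"
    "set v \<subseteq> C" "walk_end M \<Psi> v = \<Omega>"
    using assms unfolding connected_by_def by blast
  then show ?thesis
    unfolding connected_by_def by (auto intro!: exI[of _ "u @ v"])
qed

lemma connected_by_mono:
  "connected_by M C \<Phi> \<Psi> \<Longrightarrow> C \<subseteq> D \<Longrightarrow> connected_by M D \<Phi> \<Psi>"
  unfolding connected_by_def by blast

lemma connected_by_induct [consumes 1, case_names refl step]:
  assumes "connected_by M C \<Phi> \<Psi>"
    and "\<Phi> \<in> flags M \<Longrightarrow> R \<Phi>"
    and "\<And>\<Omega> i. connected_by M C \<Phi> \<Omega> \<Longrightarrow> R \<Omega> \<Longrightarrow> i \<in> C \<Longrightarrow> R (adj M i \<Omega>)"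
  shows "R \<Psi>"
proof -
  obtain w where \<Phi>: "\<Phi> \<in> flags M" and w: "set w \<subseteq> C" "walk_end M \<Phi> w = \<Psi>"
    using assms(1) unfolding connected_by_def by blast
  have "R (walk_end M \<Phi> w)" using w(1)
  proof (induction w rule: rev_induct)
    case Nil
    then show ?case using assms(2) \<Phi> by simp
  next
    case (snoc i w)
    then have "connected_by M C \<Phi> (walk_end M \<Phi> w)"
      unfolding connected_by_def using \<Phi> by auto
    then show ?case using snoc assms(3) by simp
  qed
  then show ?thesis using w(2) by simp
qed

section \<open>Parity of a colour along closed walks, and two-colourings\<close>

context pre_maniplex
begin

lemma walk_end_closed:
  "\<Phi> \<in> flags M \<Longrightarrow> set w \<subseteq> {..<n} \<Longrightarrow> walk_end M \<Phi> w \<in> flags M"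
  by (induction w arbitrary: \<Phi>) (auto simp: adj_closed)

lemma connected_by_closed:
  "connected_by M C \<Phi> \<Psi> \<Longrightarrow> C \<subseteq> {..<n} \<Longrightarrow> \<Psi> \<in> flags M"
  unfolding connected_by_def using walk_end_closed by blast

text \<open>Induction on the length: a repeated flag splits the walk into two shorter closed walks,
  whose counts add up. Without repetition the walk is a cycle or has at most two edges.\<close>

lemma even_closed_walk:
  assumes no_odd: "\<not> (\<exists>\<Phi> w. is_cycle n M \<Phi> w \<and> odd (count_list w c))"
    and "\<Phi> \<in> flags M" "set w \<subseteq> {..<n}" "walk_end M \<Phi> w = \<Phi>"
  shows "even (count_list w c)"
  using assms(2-)
proof (induction "length w" arbitrary: w \<Phi> rule: less_induct)
  case less
  show ?case
  proof (cases "distinct (map (\<lambda>k. walk_end M \<Phi> (take k w)) [0..<length w])")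
    case True
    show ?thesis
    proof (cases "length w \<ge> 3")
      case True
      then have "is_cycle n M \<Phi> w"
        unfolding is_cycle_def using less.prems \<open>distinct _\<close> by simp
      then show ?thesis using no_odd by blast
    next
      case False
      then consider "w = []" | i where "w = [i]" | i j where "w = [i, j]"
        by (cases w; cases "tl w"; cases "tl (tl w)") auto
      then show ?thesis
      proof cases
        case 1
        then show ?thesis by simp
      next
        case 2
        then show ?thesis using less.prems adj_neq by auto
      next
        \<comment> \<open>There are no multiple edges, so the walk goes back along its first edge
          and meets each colour 0 or 2 times.\<close>
        case 3
        then have ij: "i < n" "j < n" "adj M j (adj M i \<Phi>) = \<Phi>"
          using less.prems by auto
        then have "adj M i \<Phi> = adj M j \<Phi>"
          using adj_adj[OF adj_closed] less.prems(1) by metis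
        then have "i = j" using adj_distinct ij less.prems(1) by metis
        then show ?thesis using 3 by simp
      qed
    qed
  next
    case False
    then obtain a b where ab: "a < b" "b < length w"
      "walk_end M \<Phi> (take a w) = walk_end M \<Phi> (take b w)"
      unfolding distinct_conv_nth
      by (auto simp: linorder_neq_iff)
    \<comment> \<open>\<open>v\<close> is the closed piece between two visits to the same flag;
      \<open>u @ x\<close> is the walk with this piece cut out.\<close>
    define u v x where "u = take a w" and "v = drop a (take b w)" and "x = drop b w"
    have "take b w = u @ v"
      unfolding u_def v_def using ab(1)
      by (metis append_take_drop_id less_imp_le min.absorb1 take_take)
    have w: "w = u @ v @ x"
      using \<open>take b w = u @ v\<close> append_take_drop_id[of b w] unfolding x_def by simp
    have eq: "walk_end M (walk_end M \<Phi> u) v = walk_end M \<Phi> u"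
      using ab(3) \<open>take b w = u @ v\<close> unfolding u_def by (metis walk_end_simps(3))
    have len: "length v < length w" "length (u @ x) < length w"
      using ab unfolding u_def v_def x_def by auto
    have "even (count_list v c)"
      by (rule less.hyps[OF len(1), of "walk_end M \<Phi> u"])
        (use less.prems w eq walk_end_closed in auto)
    moreover have "even (count_list (u @ x) c)"
      by (rule less.hyps[OF len(2), of \<Phi>]) (use less.prems w eq in auto)
    ultimately show ?thesis by (simp add: w)
  qed
qed

end

text \<open>The colour of a flag is the parity of the number of edges of colour \<open>c\<close> on
  a walk to it from \<open>\<Phi>\<close>; \<open>even_closed_walk\<close> makes this independent of
  the walk.\<close>

lemma (in maniplex) two_colouring:
  assumes no_odd: "\<not> (\<exists>\<Phi> w. is_cycle n M \<Phi> w \<and> odd (count_list w c))"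
    and \<Phi>: "\<Phi> \<in> flags M"
  obtains \<beta> where "\<beta> \<Phi>"
    and "\<And>\<Lambda> i. \<Lambda> \<in> flags M \<Longrightarrow> i < n \<Longrightarrow> \<beta> (adj M i \<Lambda>) = (\<beta> \<Lambda> \<noteq> (i = c))"
proof -
  define \<beta> where "\<beta> \<Lambda> \<longleftrightarrow>
    (\<exists>w. set w \<subseteq> {..<n} \<and> walk_end M \<Phi> w = \<Lambda> \<and> even (count_list w c))" for \<Lambda>
  have \<beta>: "\<beta> (walk_end M \<Phi> w) = even (count_list w c)" if w: "set w \<subseteq> {..<n}" for w
  proof -
    obtain u where u: "set u \<subseteq> {..<n}" "walk_end M (walk_end M \<Phi> w) u = \<Phi>"
      using connected[OF walk_end_closed[OF \<Phi> w] \<Phi>] unfolding connected_by_def by blast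
    \<comment> \<open>The same \<open>u\<close> closes up every walk \<open>v\<close> with the end
      of \<open>w\<close>, including \<open>w\<close> itself, so all of them have the parity of
      \<open>u\<close>.\<close>
    have "even (count_list v c) = even (count_list u c)"
      if "set v \<subseteq> {..<n}" "walk_end M \<Phi> v = walk_end M \<Phi> w" for v
      using even_closed_walk[OF no_odd \<Phi>, of "v @ u"] u that by simp
    then show ?thesis unfolding \<beta>_def using w by metis
  qed
  show thesis
  proof (rule that)
    show "\<beta> \<Phi>" using \<beta>[of "[]"] by simp
    fix \<Lambda> i
    assume "\<Lambda> \<in> flags M" and i: "i < n"
    then obtain w where w: "set w \<subseteq> {..<n}" "walk_end M \<Phi> w = \<Lambda>"
      using connected[OF \<Phi>] unfolding connected_by_def by blast
    then show "\<beta> (adj M i \<Lambda>) = (\<beta> \<Lambda> \<noteq> (i = c))"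
      using \<beta>[of w] \<beta>[of "w @ [i]"] i by auto
  qed
qed

section \<open>Amalgamation of two-coloured polytopes\<close>

locale coloured_amalgamation = P: polytope n P + Q: polytope m Q
  for n m :: nat and P :: "'a colored_graph" and Q :: "'b colored_graph" +
  fixes \<beta> :: "'a \<Rightarrow> bool" and \<gamma> :: "'b \<Rightarrow> bool" and \<Phi> :: 'a and \<Psi> :: 'b
  assumes base: "\<Phi> \<in> flags P" "\<Psi> \<in> flags Q" "\<beta> \<Phi> = \<gamma> \<Psi>"
    and \<beta>_adj: "\<Lambda> \<in> flags P \<Longrightarrow> i < n \<Longrightarrow> \<beta> (adj P i \<Lambda>) = (\<beta> \<Lambda> \<noteq> (i = n - 1))"
    and \<gamma>_adj: "\<Delta> \<in> flags Q \<Longrightarrow> i < m \<Longrightarrow> \<gamma> (adj Q i \<Delta>) = (\<gamma> \<Delta> \<noteq> (i = 0))"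
begin

text \<open>An explicit description of the component of the base pair;
  \<open>flat_amalgamation_eq_A\<close> justifies it.\<close>

definition A :: "('a \<times> 'b) colored_graph" where
  "A = (amalgamation_graph n P Q)
     \<lparr>flags := {x \<in> flags P \<times> flags Q. \<beta> (fst x) = \<gamma> (snd x)}\<rparr>"

lemma mem_A [simp]:
  "(\<Lambda>, \<Delta>) \<in> flags A \<longleftrightarrow> \<Lambda> \<in> flags P \<and> \<Delta> \<in> flags Q \<and> \<beta> \<Lambda> = \<gamma> \<Delta>"
  by (auto simp: A_def)

text \<open>The three cases of the amalgamation become one condition per coordinate. The two
  conditions overlap only at \<open>i = n - 1\<close>, which acts as colour 0 on
  \<open>Q\<close>.\<close>

lemma adj_A:
  "adj A i (\<Lambda>, \<Delta>) =
     (if i < n then adj P i \<Lambda> else \<Lambda>, if n - 1 \<le> i then adj Q (i - (n - 1)) \<Delta> else \<Delta>)"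
  using P.rank_pos
  by (auto simp: A_def amalgamation_graph_def intro!: arg_cong2[of _ _ _ _ "adj Q"])

text \<open>The flags are closed under adjacency because colour \<open>n - 1\<close> switches both
  \<open>\<beta>\<close> and \<open>\<gamma>\<close>, and every other colour switches
  neither.\<close>

sublocale A: pre_maniplex "m + n - 1" A
proof
  show "m + n - 1 \<ge> 1" using P.rank_pos Q.rank_pos by linarith
next
  fix x :: "'a \<times> 'b" and i
  assume "x \<in> flags A" "i < m + n - 1"
  moreover obtain \<Lambda> \<Delta> where "x = (\<Lambda>, \<Delta>)" by (cases x)
  ultimately show "adj A i x \<in> flags A" "adj A i (adj A i x) = x" "adj A i x \<noteq> x"
    using P.rank_pos Q.rank_pos
    by (auto simp: adj_A \<beta>_adj \<gamma>_adj P.adj_closed Q.adj_closed P.adj_adj Q.adj_adj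
        P.adj_neq Q.adj_neq)
next
  fix x :: "'a \<times> 'b" and i j
  assume "x \<in> flags A" "i < m + n - 1" "j < m + n - 1" "i \<noteq> j"
  moreover obtain \<Lambda> \<Delta> where "x = (\<Lambda>, \<Delta>)" by (cases x)
  ultimately show "adj A i x \<noteq> adj A j x"
    using P.adj_distinct[of \<Lambda> i j] Q.adj_distinct[of \<Delta> "i - (n - 1)" "j - (n - 1)"]
      P.adj_neq[of \<Lambda> i] P.adj_neq[of \<Lambda> j]
      Q.adj_neq[of \<Delta> "i - (n - 1)"] Q.adj_neq[of \<Delta> "j - (n - 1)"]
    by (auto simp: adj_A split: if_splits)
qed

section \<open>Projecting walks to the factors and lifting them back\<close>

lemma fst_connected:
  assumes "connected_by A C x y" "C \<subseteq> {..<m + n - 1}"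
  shows "connected_by P {i \<in> C. i < n} (fst x) (fst y)"
  using assms(1)
proof (induction rule: connected_by_induct)
  case refl
  then show ?case by (cases x) (simp add: connected_by_refl)
next
  case (step z i)
  then show ?case by (cases z) (auto simp: adj_A intro: connected_by_step)
qed

lemma snd_connected:
  assumes "connected_by A C x y" "C \<subseteq> {..<m + n - 1}"
  shows "connected_by Q {i. i + (n - 1) \<in> C} (snd x) (snd y)"
  using assms(1)
proof (induction rule: connected_by_induct)
  case refl
  then show ?case by (cases x) (simp add: connected_by_refl)
next
  case (step z i)
  then show ?case by (cases z) (auto simp: adj_A intro: connected_by_step)
qed

text \<open>Among the colours of \<open>P\<close> only \<open>n - 1\<close> moves the second
  coordinate, and always along its edge of colour 0, an involution. As \<open>\<gamma>\<close>
  differs at the two candidates, membership in \<open>flags A\<close> decides between them.\<close>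

lemma lift_P:
  assumes "connected_by P C \<Lambda> \<Lambda>'" "C \<subseteq> {..<n}" "(\<Lambda>, \<Delta>) \<in> flags A"
  shows "\<exists>\<Delta>' \<in> {\<Delta>, adj Q 0 \<Delta>}. connected_by A C (\<Lambda>, \<Delta>) (\<Lambda>', \<Delta>')"
  using assms(1)
proof (induction rule: connected_by_induct)
  case refl
  show ?case using connected_by_refl[OF assms(3)] by blast
next
  case (step \<Omega> i)
  then obtain \<Delta>' where \<Delta>': "\<Delta>' \<in> {\<Delta>, adj Q 0 \<Delta>}" "connected_by A C (\<Lambda>, \<Delta>) (\<Omega>, \<Delta>')"
    by blast
  have c: "connected_by A C (\<Lambda>, \<Delta>) (adj A i (\<Omega>, \<Delta>'))"
    by (rule connected_by_step[OF \<Delta>'(2) \<open>i \<in> C\<close>])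
  have i: "i < n" using \<open>i \<in> C\<close> assms(2) by auto
  have "adj Q 0 \<Delta>' \<in> {\<Delta>, adj Q 0 \<Delta>}"
    using \<Delta>'(1) assms(3) Q.adj_adj Q.rank_pos by auto
  then show ?case using c i \<Delta>'(1) by (auto simp: adj_A split: if_splits)
qed

text \<open>Dual to \<open>lift_P\<close>: colour 0 of \<open>Q\<close>, shifted to
  \<open>n - 1\<close>, is the only one that moves the first coordinate.\<close>

lemma lift_Q:
  assumes "connected_by Q D \<Delta> \<Delta>'" "D \<subseteq> {..<m}" "(\<Lambda>, \<Delta>) \<in> flags A"
  shows "\<exists>\<Lambda>' \<in> {\<Lambda>, adj P (n - 1) \<Lambda>}.
    connected_by A ((\<lambda>i. i + (n - 1)) ` D) (\<Lambda>, \<Delta>) (\<Lambda>', \<Delta>')"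
  using assms(1)
proof (induction rule: connected_by_induct)
  case refl
  show ?case using connected_by_refl[OF assms(3)] by blast
next
  case (step \<Omega> i)
  let ?D = "(\<lambda>i. i + (n - 1)) ` D"
  obtain \<Lambda>' where \<Lambda>': "\<Lambda>' \<in> {\<Lambda>, adj P (n - 1) \<Lambda>}" "connected_by A ?D (\<Lambda>, \<Delta>) (\<Lambda>', \<Omega>)"
    using step by blast
  have c: "connected_by A ?D (\<Lambda>, \<Delta>) (adj A (i + (n - 1)) (\<Lambda>', \<Omega>))"
    by (rule connected_by_step[OF \<Lambda>'(2)]) (use \<open>i \<in> D\<close> in blast)
  have "adj P (n - 1) \<Lambda>' \<in> {\<Lambda>, adj P (n - 1) \<Lambda>}"
    using \<Lambda>'(1) assms(3) P.adj_adj P.rank_pos by auto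
  moreover have "i + (n - 1) < n \<longleftrightarrow> i = 0" using P.rank_pos by auto
  ultimately show ?case using c \<Lambda>'(1) by (auto simp: adj_A split: if_splits)
qed

text \<open>Lift the walk in \<open>P\<close> first. It may leave the second coordinate at
  \<open>adj Q 0 \<Delta>\<close>, from which a walk in \<open>Q\<close> can start as well because
  \<open>0 \<in> D\<close>.\<close>

lemma join:
  assumes "connected_by P C \<Lambda> \<Lambda>'" "C \<subseteq> {..<n}"
    and "connected_by Q D \<Delta> \<Delta>'" "D \<subseteq> {..<m}" "0 \<in> D"
    and "(\<Lambda>, \<Delta>) \<in> flags A" "(\<Lambda>', \<Delta>') \<in> flags A"
  shows "connected_by A (C \<union> (\<lambda>i. i + (n - 1)) ` D) (\<Lambda>, \<Delta>) (\<Lambda>', \<Delta>')"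
proof -
  let ?D = "(\<lambda>i. i + (n - 1)) ` D"
  obtain \<Delta>'' where \<Delta>'': "\<Delta>'' \<in> {\<Delta>, adj Q 0 \<Delta>}" "connected_by A C (\<Lambda>, \<Delta>) (\<Lambda>', \<Delta>'')"
    using lift_P[OF assms(1,2,6)] by blast
  have "C \<subseteq> {..<m + n - 1}" "?D \<subseteq> {..<m + n - 1}"
    using assms(2,4) P.rank_pos Q.rank_pos by force+
  note closed = this[THEN A.connected_by_closed[rotated]]
  have mem: "(\<Lambda>', \<Delta>'') \<in> flags A"
    by (rule closed(1)[OF \<Delta>''(2)])
  have "connected_by Q D \<Delta>'' \<Delta>"
    using \<Delta>''(1) assms(5) mem
      connected_by_refl[of \<Delta>'' Q D] connected_by_step[of Q D \<Delta>'' \<Delta>'' 0]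
      Q.adj_adj[of \<Delta> 0] assms(6) Q.rank_pos by auto
  then have "connected_by Q D \<Delta>'' \<Delta>'" using assms(3) connected_by_trans by metis
  then obtain \<Lambda>'' where \<Lambda>'': "\<Lambda>'' \<in> {\<Lambda>', adj P (n - 1) \<Lambda>'}"
    "connected_by A ?D (\<Lambda>', \<Delta>'') (\<Lambda>'', \<Delta>')"
    using lift_Q[OF _ assms(4) mem] by blast
  have "(\<Lambda>'', \<Delta>') \<in> flags A"
    by (rule closed(2)[OF \<Lambda>''(2)])
  \<comment> \<open>\<open>\<beta>\<close> must equal \<open>\<gamma> \<Delta>'\<close> at both
    flags, but it differs at \<open>\<Lambda>'\<close> and its neighbour of colour
    \<open>n - 1\<close>.\<close>
  then have "\<Lambda>'' = \<Lambda>'"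
    using \<Lambda>''(1) assms(7) \<beta>_adj P.rank_pos by auto
  then show ?thesis
    using \<Lambda>''(2) \<Delta>''(2) connected_by_trans connected_by_mono[of A]
    by (metis Un_upper1 Un_upper2)
qed

section \<open>The maniplex and polytope axioms\<close>

sublocale A: maniplex "m + n - 1" A
proof
  show "flags A \<noteq> {}" using base mem_A by blast
next
  fix x y :: "'a \<times> 'b"
  assume xy: "x \<in> flags A" "y \<in> flags A"
  obtain \<Lambda> \<Delta> \<Lambda>' \<Delta>' where [simp]: "x = (\<Lambda>, \<Delta>)" "y = (\<Lambda>', \<Delta>')" by (cases x, cases y)
  have "connected_by A ({..<n} \<union> (\<lambda>i. i + (n - 1)) ` {..<m}) x y"
    unfolding \<open>x = _\<close> \<open>y = _\<close>
    by (rule join) (use xy P.connected Q.connected Q.rank_pos in auto)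
  then show "connected_by A {..<m + n - 1} x y"
    by (rule connected_by_mono) (use P.rank_pos Q.rank_pos in auto)
next
  fix x :: "'a \<times> 'b" and i j
  assume "x \<in> flags A" "i < m + n - 1" "j < m + n - 1" "\<bar>int i - int j\<bar> > 1"
  moreover obtain \<Lambda> \<Delta> where "x = (\<Lambda>, \<Delta>)" by (cases x)
  ultimately show "adj A j (adj A i x) = adj A i (adj A j x)"
    using P.adj_commute[of \<Lambda> i j] Q.adj_commute[of \<Delta> "i - (n - 1)" "j - (n - 1)"]
    by (auto simp: adj_A)
qed

text \<open>The cases are the positions of \<open>n - 1\<close> relative to \<open>{i..j}\<close>.
  If the interval lies on one side, path intersection in one factor gives a walk to lift, and the
  other coordinate does not change.\<close>

sublocale A: polytope "m + n - 1" A
proof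
  fix x y :: "'a \<times> 'b" and i j
  assume xy: "x \<in> flags A" "y \<in> flags A" and ij: "i \<le> j" "j < m + n - 1"
    and up: "connected_by A {i..m + n - 1 - 1} x y" and down: "connected_by A {0..j} x y"
  obtain \<Lambda> \<Delta> \<Lambda>' \<Delta>' where [simp]: "x = (\<Lambda>, \<Delta>)" "y = (\<Lambda>', \<Delta>')" by (cases x, cases y)
  have le: "{i..m + n - 1 - 1} \<subseteq> {..<m + n - 1}" "{0..j} \<subseteq> {..<m + n - 1}"
    using ij by auto
  have P_up: "connected_by P {i..n - 1} \<Lambda> \<Lambda>'"
    using fst_connected[OF up le(1)] by (auto elim: connected_by_mono)
  have P_down: "connected_by P {k. k \<le> j \<and> k < n} \<Lambda> \<Lambda>'"
    using fst_connected[OF down le(2)] by (auto elim: connected_by_mono)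
  have Q_up: "connected_by Q {k. i \<le> k + (n - 1) \<and> k < m} \<Delta> \<Delta>'"
    using snd_connected[OF up le(1)] ij by (auto elim!: connected_by_mono)
  have Q_down: "connected_by Q {k. k + (n - 1) \<le> j} \<Delta> \<Delta>'"
    using snd_connected[OF down le(2)] by (auto elim: connected_by_mono)
  consider "j < n - 1" | "i \<le> n - 1" "n - 1 \<le> j" | "n - 1 < i" by linarith
  then show "connected_by A {i..j} x y"
  proof cases
    case 1
    then have "connected_by P {0..j} \<Lambda> \<Lambda>'"
      using P_down by (auto elim: connected_by_mono)
    then have "connected_by P {i..j} \<Lambda> \<Lambda>'"
      using P.path_intersection[OF _ _ ij(1) _ P_up] xy 1 by auto
    moreover have "{i..j} \<subseteq> {..<n}" using 1 by auto
    ultimately obtain \<Delta>'' where \<Delta>'': "\<Delta>'' \<in> {\<Delta>, adj Q 0 \<Delta>}"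
      "connected_by A {i..j} x (\<Lambda>', \<Delta>'')"
      using lift_P[of _ \<Lambda> \<Lambda>' \<Delta>] xy unfolding \<open>x = _\<close> by blast
    \<comment> \<open>Colours up to \<open>j\<close> do not move the second coordinate, and
      \<open>\<gamma>\<close> then rules out \<open>adj Q 0 \<Delta>\<close> as the end of the
      lift.\<close>
    have "{k. k + (n - 1) \<le> j} = {}" using 1 by auto
    then have "\<Delta>' = \<Delta>" using Q_down by (auto simp: connected_by_def)
    moreover have "(\<Lambda>', \<Delta>'') \<in> flags A"
      by (rule A.connected_by_closed[OF \<Delta>''(2)]) (use ij in auto)
    ultimately have "\<Delta>'' = \<Delta>'"
      using \<Delta>''(1) xy \<gamma>_adj Q.rank_pos by auto
    then show ?thesis using \<Delta>''(2) by simp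
  next
    case 2
    \<comment> \<open>The upper walk projected to \<open>P\<close> and the lower walk projected to
      \<open>Q\<close> already stay within the colours \<open>i\<close> to \<open>j\<close>;
      \<open>n - 1 \<le> j\<close> provides colour 0 for \<open>join\<close>.\<close>
    have "connected_by A ({i..n - 1} \<union> (\<lambda>k. k + (n - 1)) ` {k. k + (n - 1) \<le> j}) x y"
      unfolding \<open>x = _\<close> \<open>y = _\<close>
      by (rule join[OF P_up _ Q_down]) (use xy 2 ij P.rank_pos in auto)
    then show ?thesis by (rule connected_by_mono) (use 2 in auto)
  next
    case 3
    define i' j' where "i' = i - (n - 1)" and "j' = j - (n - 1)"
    have ij': "i' \<le> j'" "j' < m" using 3 ij by (auto simp: i'_def j'_def)
    have "connected_by Q {i'..m - 1} \<Delta> \<Delta>'"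
      using Q_up by (rule connected_by_mono) (auto simp: i'_def)
    moreover have "connected_by Q {0..j'} \<Delta> \<Delta>'"
      using Q_down by (rule connected_by_mono) (auto simp: j'_def)
    ultimately have "connected_by Q {i'..j'} \<Delta> \<Delta>'"
      using Q.path_intersection[OF _ _ ij'] xy by auto
    moreover have "{i'..j'} \<subseteq> {..<m}" using ij' by auto
    ultimately obtain \<Lambda>'' where \<Lambda>'': "\<Lambda>'' \<in> {\<Lambda>, adj P (n - 1) \<Lambda>}"
      "connected_by A ((\<lambda>k. k + (n - 1)) ` {i'..j'}) x (\<Lambda>'', \<Delta>')"
      using lift_Q[of _ \<Delta> \<Delta>' \<Lambda>] xy unfolding \<open>x = _\<close> by blast
    have "(\<lambda>k. k + (n - 1)) ` {i'..j'} \<subseteq> {i..j}"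
      using 3 ij by (auto simp: i'_def j'_def)
    with \<Lambda>''(2) have c: "connected_by A {i..j} x (\<Lambda>'', \<Delta>')" by (rule connected_by_mono)
    have "{i..n - 1} = {}" using 3 by auto
    then have "\<Lambda>' = \<Lambda>" using P_up by (auto simp: connected_by_def)
    moreover have "(\<Lambda>'', \<Delta>') \<in> flags A"
      by (rule A.connected_by_closed[OF c]) (use ij in auto)
    ultimately have "\<Lambda>'' = \<Lambda>'"
      using \<Lambda>''(1) xy \<beta>_adj P.rank_pos by auto
    then show ?thesis using c by simp
  qed
qed

section \<open>Flatness, and identification with the flat amalgamation\<close>

lemma flat_A: "flat (m + n - 1) A (int n - 2) (int n)"
  unfolding flat_def
proof (intro ballI)
  fix F G
  assume "F \<in> faces (m + n - 1) A (int n - 2)" "G \<in> faces (m + n - 1) A (int n)"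
  then obtain \<Lambda> \<Delta> \<Lambda>' \<Delta>' where
    x: "(\<Lambda>, \<Delta>) \<in> flags A"
      "F = component A {c. c < m + n - 1 \<and> int c \<noteq> int n - 2} (\<Lambda>, \<Delta>)" and
    y: "(\<Lambda>', \<Delta>') \<in> flags A"
      "G = component A {c. c < m + n - 1 \<and> int c \<noteq> int n} (\<Lambda>', \<Delta>')"
    unfolding faces_def by auto
  \<comment> \<open>The common flag is reached from \<open>F\<close> by colours from
    \<open>n - 1\<close> on, which avoid \<open>n - 2\<close>, and from \<open>G\<close> by colours
    below \<open>n\<close>.\<close>
  have "connected_by Q {..<m} \<Delta> \<Delta>'" using x y Q.connected by auto
  then obtain \<Lambda>'' where
    c: "connected_by A ((\<lambda>i. i + (n - 1)) ` {..<m}) (\<Lambda>, \<Delta>) (\<Lambda>'', \<Delta>')"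
    using lift_Q x by blast
  have z: "(\<Lambda>'', \<Delta>') \<in> flags A"
    by (rule A.connected_by_closed[OF c]) (use P.rank_pos in auto)
  have "(\<lambda>i. i + (n - 1)) ` {..<m} \<subseteq> {c. c < m + n - 1 \<and> int c \<noteq> int n - 2}"
    using P.rank_pos by auto
  then have "(\<Lambda>'', \<Delta>') \<in> F"
    unfolding x(2) component_def using connected_by_mono[OF c] by simp
  \<comment> \<open>The second coordinates agree, so the walk in \<open>Q\<close> is trivial;
    \<open>{0}\<close> serves the condition \<open>0 \<in> D\<close> of \<open>join\<close> and
    contributes only colour \<open>n - 1\<close>.\<close>
  moreover have "connected_by A ({..<n} \<union> (\<lambda>i. i + (n - 1)) ` {0}) (\<Lambda>', \<Delta>') (\<Lambda>'', \<Delta>')"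
    using y z P.connected Q.rank_pos connected_by_refl by (intro join) auto
  then have "connected_by A {c. c < m + n - 1 \<and> int c \<noteq> int n} (\<Lambda>', \<Delta>') (\<Lambda>'', \<Delta>')"
    by (rule connected_by_mono) (use P.rank_pos Q.rank_pos in auto)
  then have "(\<Lambda>'', \<Delta>') \<in> G" unfolding y(2) component_def by simp
  ultimately show "incident F G" unfolding incident_def by blast
qed

text \<open>Walks depend only on \<open>adj\<close>, which \<open>A\<close> shares with the
  amalgamation graph; since \<open>A\<close> is connected and closed under adjacency, it is the
  whole component.\<close>

lemma flat_amalgamation_eq_A: "flat_amalgamation n P \<Phi> m Q \<Psi> = A"
proof -
  let ?G = "amalgamation_graph n P Q"
  have base_A: "(\<Phi>, \<Psi>) \<in> flags A" using base by simp
  have "walk_end ?G = walk_end A" unfolding walk_end_def A_def by simp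
  then have "connected_by ?G C (\<Phi>, \<Psi>) x = connected_by A C (\<Phi>, \<Psi>) x" for C x
    using base base_A by (simp add: connected_by_def amalgamation_graph_def)
  then have "component ?G {..<m + n - 1} (\<Phi>, \<Psi>) = flags A"
    unfolding component_def
    using A.connected[OF base_A] A.connected_by_closed by blast
  then show ?thesis unfolding flat_amalgamation_def Let_def by (simp add: A_def)
qed

end

theorem theorem4p5:
  fixes P :: "'a colored_graph" and Q :: "'b colored_graph"
    and n m :: nat and \<Phi> :: 'a and \<Psi> :: 'b
  assumes "n \<ge> 1" and "m \<ge> 1"
    and "polytope n P" and "facet_bipartite n P"
    and "polytope m Q" and "vertex_bipartite m Q"
    and "\<Phi> \<in> flags P" and "\<Psi> \<in> flags Q"
  shows "polytope (m + n - 1) (flat_amalgamation n P \<Phi> m Q \<Psi>) \<and>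
         flat (m + n - 1) (flat_amalgamation n P \<Phi> m Q \<Psi>) (int n - 2) (int n)"
proof -
  interpret P: polytope n P by fact
  interpret Q: polytope m Q by fact
  obtain \<beta> where \<beta>: "\<beta> \<Phi>"
    "\<And>\<Lambda> i. \<Lambda> \<in> flags P \<Longrightarrow> i < n \<Longrightarrow> \<beta> (adj P i \<Lambda>) = (\<beta> \<Lambda> \<noteq> (i = n - 1))"
    using P.two_colouring[OF assms(4)[unfolded facet_bipartite_def] assms(7)] by blast
  obtain \<gamma> where \<gamma>: "\<gamma> \<Psi>"
    "\<And>\<Delta> i. \<Delta> \<in> flags Q \<Longrightarrow> i < m \<Longrightarrow> \<gamma> (adj Q i \<Delta>) = (\<gamma> \<Delta> \<noteq> (i = 0))"
    using Q.two_colouring[OF assms(6)[unfolded vertex_bipartite_def] assms(8)] by blast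
  \<comment> \<open>Both colourings are true at the base flags, which gives the normalisation
    \<open>\<beta> \<Phi> = \<gamma> \<Psi>\<close>.\<close>
  interpret coloured_amalgamation n m P Q \<beta> \<gamma> \<Phi> \<Psi>
    by unfold_locales (use assms \<beta> \<gamma> in auto)
  show ?thesis
    unfolding flat_amalgamation_eq_A using A.polytope_axioms flat_A by blast
qed

end
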